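(* Let $q$ be a prime power. Pick positive integers $r$ and $n$ with $r\equiv n \pmod{q+1}$, distinct elements $u,v\in\mu_{q+1}$, and elements $a,b\in\mathbb{F}_{q^2}^*$, and write \[ B(X) := a(X+u)^n + b(X+v)^n \in \mathbb{F}_{q^2}[X]. \] Then the polynomial $f(X):=X^r B(X^{q-1})$ permutes $\mathbb{F}_{q^2}$ (i.e., the map $c\mapsto f(c)$ is a bijection $\mathbb{F}_{q^2}\to\mathbb{F}_{q^2}$) if and only if $(b/a)^{q-1}\neq (v/u)^n$ and $\gcd(rn,q-1)=1$.
   Context: $\mu_{q+1}$ denotes the set of $(q+1)$-th roots of unity in $\mathbb{F}_{q^2}^*$. *)

theory Defs
  imports "HOL-Number_Theory.Number_Theory" "HOL-Computational_Algebra.Computational_Algebra"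
    "HOL-Library.Cardinality"
begin

text \<open>The field with $q^2$ elements is modelled by a type \<open>'a :: {field, finite}\<close> together with
  the assumption \<open>CARD('a) = q ^ 2\<close>.\<close>

definition unity_roots :: "nat \<Rightarrow> 'a::field set" where
  "unity_roots d = {x. x \<noteq> 0 \<and> x ^ d = 1}"

definition B_poly :: "nat \<Rightarrow> 'a \<Rightarrow> 'a \<Rightarrow> 'a \<Rightarrow> 'a \<Rightarrow> 'a::field poly" where
  "B_poly n u v a b = smult a ([:u, 1:] ^ n) + smult b ([:v, 1:] ^ n)"

text \<open>\<open>monom 1 k\<close> is $X^k$, so for a polynomial \<open>B\<close> this is $X^r B(X^{q-1})$.\<close>

definition f_poly :: "nat \<Rightarrow> nat \<Rightarrow> 'a poly \<Rightarrow> 'a::field poly" where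
  "f_poly q r B = monom 1 r * pcompose B (monom 1 (q - 1))"

definition permutation_polynomial :: "'a::field poly \<Rightarrow> bool" where
  "permutation_polynomial f \<longleftrightarrow> bij (\<lambda>c. poly f c)"

end

theory Submission
  imports Defs
begin

text \<open>
  Let \<open>K\<close> be the subfield with \<open>q\<close> elements. For \<open>w\<close> in $\mu_{q+1}$ the \<open>K\<close>-linear map
  $c \mapsto c^q + w c$ has its values in the line $\{y : w y^q = y\}$, so dividing by a nonzero
  element of that line turns it into a linear form with values in \<open>K\<close>. The forms \<open>s\<close>, \<open>t\<close>
  obtained from $w = u$ and $w = v$ are coordinates on the field over \<open>K\<close>, and
  $f(c) = c^{r-n} (A s(c)^n + B t(c)^n)$, where $c^{r-n}$ lies in \<open>K\<close> because
  $r \equiv n$ modulo $q+1$. The condition $(b/a)^{q-1} \neq (v/u)^n$ says that \<open>A\<close> and \<open>B\<close> are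
  linearly independent over \<open>K\<close>. If they are dependent, the image of \<open>f\<close> lies in a line;
  otherwise $f(c)$ determines $(s(c):t(c))$ up to \<open>n\<close>-th roots of unity in \<open>K\<close>, and
  $f(\lambda c) = \lambda^r f(c)$ for \<open>\<lambda>\<close> in \<open>K\<close> controls each line through the origin.
\<close>

section \<open>Powers in fields and coprime exponents\<close>

lemma finite_field_power_card:
  fixes x :: "'a :: {field, finite}"
  shows "x ^ CARD('a) = x"
proof (cases "x = 0")
  case False
  \<comment> \<open>Multiplication by \<open>x\<close> permutes the nonzero elements, so both
    products agree and the common product cancels.\<close>
  have "(\<Prod>y\<in>UNIV-{0}. x * y) = (\<Prod>y\<in>UNIV-{0}. y)"
    by (rule prod.reindex_bij_witness[of _ "\<lambda>y. y / x" "\<lambda>y. x * y"]) (use False in auto)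
  hence "x ^ (CARD('a) - 1) * \<Prod>(UNIV-{0::'a}) = 1 * \<Prod>(UNIV-{0::'a})"
    by (simp add: prod.distrib)
  hence "x ^ (CARD('a) - 1) = 1"
    by (subst (asm) mult_right_cancel) auto
  moreover have "CARD('a) = Suc (CARD('a) - 1)"
    by simp
  ultimately show ?thesis
    by (metis mult.right_neutral power_Suc)
qed (simp add: power_0_left)

text \<open>The polynomial \<open>X ^ d - w\<close> has at most \<open>d\<close> roots; the bound
  with \<open>Suc d\<close> leaves room for discarding zero as well.\<close>

lemma exists_power_neq:
  fixes w :: "'a :: {field, finite}"
  assumes "0 < d" and "Suc d < CARD('a)"
  obtains x where "x \<noteq> 0" and "x ^ d \<noteq> w"
proof -
  define p where "p = monom 1 d + [:-w:]"
  have deg: "degree p = d"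
    unfolding p_def using assms by (subst degree_add_eq_left) (auto simp: degree_monom_eq)
  hence "card {x. poly p x = 0} \<le> d"
    using card_poly_roots_bound[of p] assms by force
  moreover have "{x. poly p x = 0} = {x. x ^ d = w}"
    by (auto simp: p_def poly_monom)
  ultimately have "card (insert 0 {x. x ^ d = w}) < CARD('a)"
    using assms by (intro le_less_trans[OF card_insert_le_m1[of "Suc d"]]) auto
  hence "insert 0 {x. x ^ d = w} \<noteq> UNIV"
    by auto
  thus thesis
    using that by blast
qed

lemma power_eq_1_coprime:
  fixes x :: "'a :: field"
  assumes "coprime m k" and "x \<noteq> 0" and "x ^ m = 1" and "x ^ k = 1"
  shows "x = 1"
\<comment> \<open>\<open>bezout_nat\<close> needs \<open>m\<close> nonzero; for \<open>m = 0\<close>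
  coprimality forces \<open>k = 1\<close>.\<close>
proof (cases "m = 0")
  case False
  then obtain i j where "m * i = k * j + 1"
    using bezout_nat[of m k] assms(1) by auto
  hence "(x ^ m) ^ i = (x ^ k) ^ j * x"
    by (metis power_add power_mult power_one_right)
  thus ?thesis
    using assms by simp
qed (use assms in auto)

text \<open>Bezout inverts \<open>m\<close> modulo \<open>k\<close>. Taking the root among the
  powers of \<open>y\<close> keeps it in every subfield that contains \<open>y\<close>.\<close>

lemma coprime_root_exists:
  fixes y :: "'a :: field"
  assumes "coprime m k" and "y ^ k = 1"
  shows "\<exists>e. (y ^ e) ^ m = y"
proof (cases "m = 0")
  case False
  then obtain i j where "m * i = k * j + 1"
    using bezout_nat[of m k] assms(1) by auto
  hence "(y ^ i) ^ m = (y ^ k) ^ j * y"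
    by (metis mult.commute power_add power_mult power_one_right)
  thus ?thesis
    using assms by auto
qed (use assms in auto)

section \<open>The subfield \<open>K\<close> and the Frobenius map\<close>

locale quadratic_extension =
  fixes q :: nat and type :: "'a :: {field, finite} itself"
  assumes primepow_q: "primepow q" and card_eq: "CARD('a) = q ^ 2"
begin

definition K :: "'a set" where "K = {x. x ^ q = x}"

lemma q_gt_1: "q > 1"
  using primepow_gt_Suc_0[OF primepow_q] by simp

lemma power_q: "x ^ q = x * x ^ (q - 1)" for x :: 'a
  using q_gt_1 by (metis Suc_diff_1 less_trans power_Suc zero_less_one)

lemma card_minus_1: "q ^ 2 - 1 = (q - 1) * (q + 1)"
  using q_gt_1 by (simp add: power2_eq_square algebra_simps)

lemma power_card_minus_1:
  fixes x :: 'a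
  assumes "x \<noteq> 0"
  shows "x ^ ((q - 1) * (q + 1)) = 1"
proof -
  have "x * x ^ (q ^ 2 - 1) = x"
    using finite_field_power_card[of x] q_gt_1 by (simp add: card_eq flip: power_Suc)
  thus ?thesis
    using assms by (simp only: card_minus_1 mult_cancel_left1) simp
qed

lemma frobenius_twice: "(x ^ q) ^ q = x" for x :: 'a
  using finite_field_power_card[of x] by (simp add: card_eq power2_eq_square flip: power_mult)

text \<open>The characteristic is a prime dividing \<open>q ^ 2\<close>, so \<open>q\<close> is a
  power of it.\<close>

lemma frobenius_add: "(x + y) ^ q = x ^ q + y ^ q" for x y :: 'a
proof -
  obtain p k where pk: "prime p" "k > 0" "q = p ^ k"
    using primepow_q unfolding primepow_def by blast
  have char: "prime CHAR('a)"
    using finite_imp_CHAR_pos[where 'a = 'a] prime_CHAR_semidom[where 'a = 'a] by simp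
  moreover have "CHAR('a) dvd p ^ (k * 2)"
    using CHAR_dvd_CARD[where 'a = 'a] pk by (simp add: card_eq power_mult)
  ultimately have "CHAR('a) = p"
    using pk prime_dvd_power primes_dvd_imp_eq by blast
  thus ?thesis
    using freshmans_dream'[OF char] pk by metis
qed

lemma frobenius_diff: "(x - y) ^ q = x ^ q - y ^ q" for x y :: 'a
  using frobenius_add[of "x - y" y] by (simp add: algebra_simps)

lemma K_iff: "x \<noteq> 0 \<Longrightarrow> x \<in> K \<longleftrightarrow> x ^ (q - 1) = 1"
  by (auto simp: K_def power_q)

lemma zero_in_K: "0 \<in> K"
  using q_gt_1 by (simp add: K_def)

lemma one_in_K: "1 \<in> K"
  by (simp add: K_def)

lemma K_mult: "x \<in> K \<Longrightarrow> y \<in> K \<Longrightarrow> x * y \<in> K"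
  by (simp add: K_def power_mult_distrib)

lemma K_divide: "x \<in> K \<Longrightarrow> y \<in> K \<Longrightarrow> x / y \<in> K"
  by (simp add: K_def power_divide)

lemma K_add: "x \<in> K \<Longrightarrow> y \<in> K \<Longrightarrow> x + y \<in> K"
  by (simp add: K_def frobenius_add)

lemma K_uminus: "x \<in> K \<Longrightarrow> - x \<in> K"
  using frobenius_diff[of 0 x] q_gt_1 by (simp add: K_def)

lemma K_power: "x \<in> K \<Longrightarrow> x ^ m \<in> K"
  unfolding K_def by (metis (mono_tags) mem_Collect_eq mult.commute power_mult)

lemma not_in_K_exists: "\<exists>x. x \<notin> K"
proof -
  have "Suc (q - 1) < CARD('a)"
    using q_gt_1 by (simp add: card_eq power2_eq_square)
  then obtain x :: 'a where "x \<noteq> 0" "x ^ (q - 1) \<noteq> 1"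
    using exists_power_neq[of "q - 1"] q_gt_1 by (metis zero_less_diff)
  thus ?thesis
    using K_iff by blast
qed

text \<open>For a common prime factor \<open>p\<close> of \<open>m\<close> and \<open>q - 1\<close>,
  write \<open>q ^ 2 - 1 = p * d\<close>. Any \<open>x ^ d\<close> other than 1 has order
  \<open>p\<close>, so its powers with exponents \<open>m\<close> and \<open>q - 1\<close> are both
  1.\<close>

lemma root_of_unity_in_K:
  assumes "\<not> coprime m (q - 1)"
  obtains z where "z \<in> K" and "z \<noteq> 0" and "z \<noteq> 1" and "z ^ m = 1"
proof -
  obtain p where p: "prime p" "p dvd m" "p dvd q - 1"
    using assms prime_factor_nat[of "gcd m (q - 1)"]
    unfolding coprime_iff_gcd_eq_1 by (metis gcd_greatest_iff)
  then obtain d where d: "q ^ 2 - 1 = p * d"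
    by (metis card_minus_1 dvdE dvd_mult2)
  have "q ^ 2 - 1 > 0"
    unfolding card_minus_1 using q_gt_1 by simp
  hence "d > 0" "d < q ^ 2 - 1"
    unfolding d using prime_gt_1_nat[OF p(1)] by auto
  hence "Suc d < CARD('a)"
    by (simp add: card_eq)
  then obtain x :: 'a where x: "x \<noteq> 0" "x ^ d \<noteq> 1"
    using exists_power_neq \<open>d > 0\<close> by blast
  have "(x ^ d) ^ p = 1"
    using power_card_minus_1[OF x(1)] unfolding card_minus_1[symmetric] d
    by (simp add: mult.commute flip: power_mult)
  hence "(x ^ d) ^ m = 1" "(x ^ d) ^ (q - 1) = 1"
    using p by (auto elim!: dvdE simp: power_mult)
  thus thesis
    using that x K_iff[of "x ^ d"] by auto
qed

text \<open>Frobenius is an involution, so it sends \<open>x ^ q + w * x\<close> to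
  \<open>x + w ^ q * x ^ q\<close>; multiplying by \<open>w\<close> restores the sum because
  \<open>w * w ^ q = 1\<close>.\<close>

lemma frobenius_line:
  fixes w x :: 'a
  assumes "w ^ (q + 1) = 1"
  shows "w * (x ^ q + w * x) ^ q = x ^ q + w * x"
  using assms
  by (simp add: frobenius_add frobenius_twice power_mult_distrib distrib_left flip: mult.assoc)

text \<open>Any nonzero value of \<open>x ^ q + w * x\<close> serves; for nonzero \<open>x\<close>
  it vanishes only if \<open>x ^ (q - 1) = - w\<close>.\<close>

lemma line_exists:
  fixes w :: 'a
  assumes "w ^ (q + 1) = 1"
  obtains y where "y \<noteq> 0" and "w * y ^ q = y"
proof -
  have "Suc (q - 1) < CARD('a)"
    using q_gt_1 by (simp add: card_eq power2_eq_square)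
  then obtain x :: 'a where x: "x \<noteq> 0" "x ^ (q - 1) \<noteq> - w"
    using exists_power_neq[of "q - 1"] q_gt_1 by (metis zero_less_diff)
  have "x ^ q + w * x = x * (x ^ (q - 1) + w)"
    by (simp add: power_q algebra_simps)
  hence "x ^ q + w * x \<noteq> 0"
    using x by (auto simp: add_eq_0_iff2)
  thus thesis
    using that frobenius_line[OF assms] by blast
qed

end

section \<open>Coordinates over \<open>K\<close>\<close>

locale line_coordinates = quadratic_extension q type
  for q :: nat and type :: "'a :: {field, finite} itself" +
  fixes u v \<alpha> \<beta> :: 'a
  assumes u_root: "u ^ (q + 1) = 1" and v_root: "v ^ (q + 1) = 1" and u_neq_v: "u \<noteq> v"
    and \<alpha>_nz: "\<alpha> \<noteq> 0" and \<alpha>_line: "u * \<alpha> ^ q = \<alpha>"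
    and \<beta>_nz: "\<beta> \<noteq> 0" and \<beta>_line: "v * \<beta> ^ q = \<beta>"
begin

definition s :: "'a \<Rightarrow> 'a" where "s c = (c ^ q + u * c) / \<alpha>"
definition t :: "'a \<Rightarrow> 'a" where "t c = (c ^ q + v * c) / \<beta>"

lemma form_in_K:
  assumes "w ^ (q + 1) = 1" and "\<gamma> \<noteq> 0" and "w * \<gamma> ^ q = \<gamma>"
  shows "(c ^ q + w * c) / \<gamma> \<in> K"
proof -
  have "w \<noteq> 0"
    using assms(1) by auto
  have "(c ^ q + w * c) / \<gamma> = (w * (c ^ q + w * c) ^ q) / (w * \<gamma> ^ q)"
    using assms(3) frobenius_line[OF assms(1)] by simp
  thus ?thesis
    using \<open>w \<noteq> 0\<close> by (simp add: K_def power_divide frobenius_twice)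
qed

lemma s_in_K: "s c \<in> K"
  unfolding s_def by (rule form_in_K[OF u_root \<alpha>_nz \<alpha>_line])

lemma t_in_K: "t c \<in> K"
  unfolding t_def by (rule form_in_K[OF v_root \<beta>_nz \<beta>_line])

lemma s_scale: "l \<in> K \<Longrightarrow> s (l * c) = l * s c"
  by (simp add: s_def K_def power_mult_distrib algebra_simps)

lemma t_scale: "l \<in> K \<Longrightarrow> t (l * c) = l * t c"
  by (simp add: t_def K_def power_mult_distrib algebra_simps)

text \<open>Subtracting the two forms cancels \<open>c ^ q\<close>, so \<open>c\<close> is recovered
  linearly from \<open>s c\<close> and \<open>t c\<close>.\<close>

lemma coordinates: "(u - v) * c = \<alpha> * s c - \<beta> * t c"
proof -
  have "\<alpha> * s c = c ^ q + u * c" "\<beta> * t c = c ^ q + v * c"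
    using \<alpha>_nz \<beta>_nz by (simp_all add: s_def t_def)
  thus ?thesis
    by (simp add: algebra_simps)
qed

lemma coordinates_inject: "s c = s d \<Longrightarrow> t c = t d \<Longrightarrow> c = d"
  using coordinates[of c] coordinates[of d] u_neq_v
  by (metis mult_left_cancel right_minus_eq)

lemma s_0: "s 0 = 0" and t_0: "t 0 = 0"
  using q_gt_1 by (simp_all add: s_def t_def)

lemma coordinates_surj:
  assumes "x \<in> K" and "y \<in> K"
  obtains c where "s c = x" and "t c = y"
proof -
  \<comment> \<open>The only candidate, found by solving \<open>coordinates\<close> for
    \<open>c\<close>. Its \<open>q\<close>-th power follows from the action of Frobenius on
    \<open>u\<close>, \<open>v\<close>, \<open>\<alpha>\<close> and \<open>\<beta>\<close>.\<close>
  define c where "c = (\<alpha> * x - \<beta> * y) / (u - v)"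
  have nz: "u \<noteq> 0" "v \<noteq> 0" "u - v \<noteq> 0"
    using u_root v_root u_neq_v by auto
  have uq: "u ^ q = 1 / u" and vq: "v ^ q = 1 / v"
    using u_root v_root nz by (simp_all add: field_simps)
  have aq: "\<alpha> ^ q = \<alpha> / u" and bq: "\<beta> ^ q = \<beta> / v"
    using \<alpha>_line \<beta>_line nz by (simp_all add: field_simps)
  have xy: "x ^ q = x" "y ^ q = y"
    using assms by (auto simp: K_def)
  have "(u - v) ^ q = (v - u) / (u * v)"
    using nz by (simp add: frobenius_diff uq vq field_simps)
  hence "c ^ q = (\<alpha> / u * x - \<beta> / v * y) / ((v - u) / (u * v))"
    by (simp add: c_def power_divide frobenius_diff power_mult_distrib aq bq xy)
  also have "\<dots> = (u * \<beta> * y - v * \<alpha> * x) / (u - v)"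
    using nz by (simp add: divide_simps) (simp add: algebra_simps)
  finally have cq: "c ^ q = (u * \<beta> * y - v * \<alpha> * x) / (u - v)" .
  have "c ^ q + u * c = (u - v) * (\<alpha> * x) / (u - v)"
    unfolding cq unfolding c_def by (simp add: algebra_simps flip: add_divide_distrib)
  moreover have "c ^ q + v * c = (u - v) * (\<beta> * y) / (u - v)"
    unfolding cq unfolding c_def by (simp add: algebra_simps flip: add_divide_distrib)
  ultimately have "s c = x" "t c = y"
    using nz \<alpha>_nz \<beta>_nz by (simp_all add: s_def t_def)
  thus thesis
    using that by blast
qed

end

section \<open>The map \<open>F\<close> and its injectivity\<close>

locale weighted_power_map = line_coordinates q type u v \<alpha> \<beta>
  for q :: nat and type :: "'a :: {field, finite} itself" and u v \<alpha> \<beta> :: 'a +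
  fixes r n :: nat and A B :: 'a
  assumes r_pos: "r > 0" and n_pos: "n > 0" and r_cong_n: "[r = n] (mod (q + 1))"
    and A_nz: "A \<noteq> 0" and B_nz: "B \<noteq> 0"
begin

text \<open>The power of \<open>c\<close> with exponent \<open>r - n\<close>, written as a quotient
  since \<open>r < n\<close> is possible; its value at 0 is 0 because \<open>r > 0\<close>.\<close>

definition M :: "'a \<Rightarrow> 'a" where "M c = c ^ r / c ^ n"
definition F :: "'a \<Rightarrow> 'a" where "F c = M c * (A * s c ^ n + B * t c ^ n)"

lemma M_nz: "c \<noteq> 0 \<Longrightarrow> M c \<noteq> 0"
  by (simp add: M_def)

text \<open>For nonzero \<open>c\<close>, the element \<open>c ^ (q - 1)\<close> is a (q+1)-th root
  of unity, so its \<open>r\<close>-th and \<open>n\<close>-th powers coincide.\<close>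

lemma M_in_K: "M c \<in> K"
proof (cases "c = 0")
  case False
  define x where "x = c ^ (q - 1)"
  have x: "x ^ (q + 1) = 1"
    using power_card_minus_1[OF False] unfolding x_def by (simp only: power_mult)
  have "x ^ m = x ^ (m mod (q + 1))" for m
  proof -
    have "x ^ m = x ^ ((q + 1) * (m div (q + 1)) + m mod (q + 1))"
      by (simp only: mult_div_mod_eq)
    also have "\<dots> = x ^ (m mod (q + 1))"
      unfolding power_add[of x "(q + 1) * _"] power_mult x by simp
    finally show ?thesis .
  qed
  hence "x ^ r = x ^ n"
    using r_cong_n unfolding cong_def by metis
  hence "(c ^ r) ^ (q - 1) = (c ^ n) ^ (q - 1)"
    by (simp add: x_def mult.commute flip: power_mult)
  hence "M c ^ (q - 1) = 1"
    using False by (simp add: M_def power_divide)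
  thus ?thesis
    using K_iff M_nz False by blast
qed (use r_pos zero_in_K in \<open>simp add: M_def power_0_left\<close>)

lemma F_0: "F 0 = 0"
  using r_pos by (simp add: F_def M_def)

text \<open>The factor \<open>M\<close> contributes degree \<open>r - n\<close>, and the
  \<open>n\<close>-th powers of the \<open>K\<close>-linear forms contribute
  \<open>n\<close>.\<close>

lemma F_scale:
  assumes "l \<in> K"
  shows "F (l * c) = l ^ r * F c"
proof (cases "l = 0 \<or> c = 0")
  case False
  thus ?thesis
    using assms by (simp add: F_def M_def s_scale[OF assms] t_scale[OF assms] power_mult_distrib)
      (simp add: field_simps)
qed (use r_pos F_0 in auto)

text \<open>Otherwise all values of \<open>F\<close> lie in the line \<open>B * K\<close>, a proper
  subset, whereas an injective self-map of a finite set is onto.\<close>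

lemma F_inj_imp_independent:
  assumes "inj F"
  shows "A / B \<notin> K"
proof
  assume AB: "A / B \<in> K"
  have "F c / B \<in> K" for c
  proof -
    have "F c / B = M c * (A / B * s c ^ n + t c ^ n)"
      using B_nz by (simp add: F_def field_simps)
    also have "\<dots> \<in> K"
      by (intro K_mult K_add K_power M_in_K s_in_K t_in_K AB)
    finally show ?thesis .
  qed
  moreover have "surj F"
    using assms by (rule finite_UNIV_inj_surj[OF finite])
  moreover obtain x :: 'a where "x \<notin> K"
    using not_in_K_exists by blast
  ultimately show False
    using B_nz by (metis nonzero_mult_div_cancel_left surjD)
qed

text \<open>A nontrivial \<open>r\<close>-th root of unity \<open>z\<close> in \<open>K\<close>
  would give \<open>F z = F 1\<close> by homogeneity.\<close>

lemma F_inj_imp_coprime_r: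
  assumes "inj F"
  shows "coprime r (q - 1)"
proof (rule ccontr)
  assume "\<not> coprime r (q - 1)"
  then obtain z where "z \<in> K" "z \<noteq> 1" "z ^ r = 1"
    using root_of_unity_in_K by metis
  hence "F (z * 1) = F 1"
    using F_scale[of z 1] by simp
  with assms \<open>z \<noteq> 1\<close> show False
    by (auto dest: injD)
qed

text \<open>For a nontrivial \<open>n\<close>-th root of unity \<open>z\<close> in \<open>K\<close>,
  the points with coordinates (1, 1) and (1, z) have values differing only by a factor in
  \<open>K\<close>. This factor is an \<open>r\<close>-th power in \<open>K\<close>, so rescaling
  one point makes the values equal, although the points are not proportional.\<close>

lemma F_inj_imp_coprime_n:
  assumes "inj F"
  shows "coprime n (q - 1)"
proof (rule ccontr)
  assume "\<not> coprime n (q - 1)"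
  then obtain z where z: "z \<in> K" "z \<noteq> 1" "z ^ n = 1"
    using root_of_unity_in_K by metis
  obtain c where c: "s c = 1" "t c = 1"
    using coordinates_surj one_in_K by metis
  obtain d where d: "s d = 1" "t d = z"
    using coordinates_surj one_in_K z by metis
  have "c \<noteq> 0" "d \<noteq> 0"
    using c(1) d(1) s_0 by (metis zero_neq_one)+
  hence nz: "M c \<noteq> 0" "M d \<noteq> 0"
    by (simp_all add: M_nz)
  have "M c / M d \<in> K"
    using K_divide M_in_K by blast
  hence "(M c / M d) ^ (q - 1) = 1"
    using K_iff nz by auto
  then obtain e where e: "((M c / M d) ^ e) ^ r = M c / M d"
    using coprime_root_exists[OF F_inj_imp_coprime_r[OF assms]] by blast
  define l where "l = (M c / M d) ^ e"
  have l: "l \<in> K" "l ^ r = M c / M d"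
    unfolding l_def using e \<open>M c / M d \<in> K\<close> K_power by auto
  have "F (l * d) = F c"
    using l nz c d z by (simp add: F_scale) (simp add: F_def)
  hence "l * d = c"
    using assms by (auto dest: injD)
  hence "l * 1 = 1" "l * z = 1"
    using s_scale[OF l(1), of d] t_scale[OF l(1), of d] c d by auto
  thus False
    using z by simp
qed

lemma independent:
  assumes "A / B \<notin> K" and "x \<in> K" and "y \<in> K" and "A * x + B * y = 0"
  shows "x = 0 \<and> y = 0"
proof -
  have "x = 0"
  proof (rule ccontr)
    assume "x \<noteq> 0"
    hence "A / B = - y / x"
      using assms(4) B_nz by (simp add: field_simps eq_neg_iff_add_eq_0)
    thus False
      using assms K_divide K_uminus by metis
  qed
  thus ?thesis
    using assms B_nz by simp
qed

text \<open>Independence splits \<open>F c = F d\<close> into one equation per coordinate. Comparing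
  the two eliminates \<open>M\<close> and leaves an \<open>n\<close>-th root of unity in
  \<open>K\<close>, which must be 1.\<close>

lemma F_eq_imp_scaled:
  assumes "A / B \<notin> K" and cop: "coprime n (q - 1)" and "c \<noteq> 0" and "d \<noteq> 0" and "F c = F d"
  shows "\<exists>l\<in>K. d = l * c"
proof -
  define x y x' y' where "x = s c" and "y = t c" and "x' = s d" and "y' = t d"
  note defs = x_def y_def x'_def y'_def
  have K: "x \<in> K" "y \<in> K" "x' \<in> K" "y' \<in> K"
    unfolding defs by (intro s_in_K t_in_K)+
  have "A * (M c * x ^ n + - (M d * x' ^ n)) + B * (M c * y ^ n + - (M d * y' ^ n)) = 0"
    using assms(5) by (simp add: F_def defs algebra_simps)
  moreover have "M c * x ^ n + - (M d * x' ^ n) \<in> K" "M c * y ^ n + - (M d * y' ^ n) \<in> K"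
    by (intro K_add K_uminus K_mult K_power M_in_K K)+
  ultimately have "M c * x ^ n + - (M d * x' ^ n) = 0 \<and> M c * y ^ n + - (M d * y' ^ n) = 0"
    using independent assms(1) by blast
  hence eq: "M c * x ^ n = M d * x' ^ n" "M c * y ^ n = M d * y' ^ n"
    by simp_all
  have M: "M c \<noteq> 0" "M d \<noteq> 0"
    using M_nz assms by auto
  have zero: "x = 0 \<longleftrightarrow> x' = 0" "y = 0 \<longleftrightarrow> y' = 0"
    using eq M n_pos by (metis mult_eq_0_iff power_eq_0_iff)+
  have scaled: ?thesis if "l \<in> K" "x' = l * x" "y' = l * y" for l
  proof -
    have "d = l * c"
      using that coordinates_inject[of d "l * c"] by (simp add: s_scale t_scale defs)
    with that show ?thesis
      by blast
  qed
  show ?thesis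
  \<comment> \<open>A coordinate vanishes at both points or at neither, so if one vanishes the other
    alone fixes the scalar.\<close>
  proof (cases "x = 0")
    case True
    have "y \<noteq> 0"
      using True coordinates_inject[of c 0] assms(3) by (auto simp: defs s_0 t_0)
    thus ?thesis
      using True zero K by (intro scaled[of "y' / y"]) (auto intro: K_divide)
  next
    case False
    show ?thesis
    proof (cases "y = 0")
      case True
      thus ?thesis
        using False zero K by (intro scaled[of "x' / x"]) (auto intro: K_divide)
    next
      \<comment> \<open>The element \<open>z\<close> is the quotient of the two scaling factors
        \<open>y' / y\<close> and \<open>x' / x\<close>.\<close>
      case y: False
      define z where "z = (x * y') / (x' * y)"
      have nz: "x \<noteq> 0" "y \<noteq> 0" "x' \<noteq> 0" "y' \<noteq> 0"
        using False y zero by auto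
      have "(M c * x ^ n) * (M d * y' ^ n) = (M d * x' ^ n) * (M c * y ^ n)"
        using eq by simp
      hence "x ^ n * y' ^ n = x' ^ n * y ^ n"
        using M by (simp add: mult_ac)
      hence "z ^ n = 1"
        using nz by (simp add: z_def power_divide power_mult_distrib)
      moreover have "z \<in> K" "z \<noteq> 0"
        using K nz by (auto simp: z_def intro!: K_divide K_mult)
      ultimately have "z = 1"
        using power_eq_1_coprime[OF cop] K_iff by blast
      hence "x * y' = x' * y"
        using nz by (simp add: z_def)
      thus ?thesis
        using nz K by (intro scaled[of "x' / x"]) (auto intro: K_divide simp: field_simps)
    qed
  qed
qed

text \<open>By independence \<open>F\<close> vanishes only at 0. Equal values at nonzero points
  force \<open>d = l * c\<close> with \<open>l\<close> in \<open>K\<close>, and homogeneity then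
  gives \<open>l ^ r = 1\<close>.\<close>

lemma F_injI:
  assumes AB: "A / B \<notin> K" and copr: "coprime r (q - 1)" and copn: "coprime n (q - 1)"
  shows "inj F"
proof -
  have F_nz: "F c \<noteq> 0" if "c \<noteq> 0" for c
  proof
    assume "F c = 0"
    hence "A * s c ^ n + B * t c ^ n = 0"
      using M_nz[OF that] by (simp add: F_def)
    hence "s c ^ n = 0 \<and> t c ^ n = 0"
      by (intro independent AB K_power s_in_K t_in_K)
    thus False
      using coordinates_inject[of c 0] that by (simp add: s_0 t_0)
  qed
  show ?thesis
  proof (rule injI)
    fix c d assume eq: "F c = F d"
    show "c = d"
    proof (cases "c = 0 \<or> d = 0")
      case True
      thus ?thesis
        using eq F_nz F_0 by metis
    next
      case False
      then obtain l where l: "l \<in> K" "d = l * c"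
        using F_eq_imp_scaled[OF AB copn _ _ eq] by blast
      hence "l ^ r = 1"
        using F_scale[of l c] eq F_nz[of c] False by simp
      moreover have "l \<noteq> 0"
        using l False by auto
      ultimately have "l = 1"
        using power_eq_1_coprime[OF copr] K_iff l by blast
      thus ?thesis
        using l by simp
    qed
  qed
qed

lemma inj_F_iff: "inj F \<longleftrightarrow> A / B \<notin> K \<and> coprime (r * n) (q - 1)"
  using F_injI F_inj_imp_independent F_inj_imp_coprime_r F_inj_imp_coprime_n by auto

end

section \<open>From the polynomial to the map \<open>F\<close>\<close>

theorem theorem1p1:
  fixes q r n :: nat
    and u v a b :: "'a :: {field, finite}"
  assumes "primepow q"
    and "CARD('a) = q ^ 2"
    and "r > 0" and "n > 0"
    and "[r = n] (mod (q + 1))"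
    and "u \<in> unity_roots (q + 1)" and "v \<in> unity_roots (q + 1)" and "u \<noteq> v"
    and "a \<noteq> 0" and "b \<noteq> 0"
  shows "permutation_polynomial (f_poly q r (B_poly n u v a b)) \<longleftrightarrow>
    (b / a) ^ (q - 1) \<noteq> (v / u) ^ n \<and> gcd (r * n) (q - 1) = 1"
proof -
  interpret quadratic_extension q "TYPE('a)"
    using assms by unfold_locales
  have u: "u ^ (q + 1) = 1" "u \<noteq> 0" and v: "v ^ (q + 1) = 1" "v \<noteq> 0"
    using assms by (auto simp: unity_roots_def)
  obtain \<alpha> where \<alpha>: "\<alpha> \<noteq> 0" "u * \<alpha> ^ q = \<alpha>"
    using line_exists[OF u(1)] by blast
  obtain \<beta> where \<beta>: "\<beta> \<noteq> 0" "v * \<beta> ^ q = \<beta>"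
    using line_exists[OF v(1)] by blast
  \<comment> \<open>The factors \<open>\<alpha> ^ n\<close> and \<open>\<beta> ^ n\<close> undo the
    normalisation of \<open>s\<close> and \<open>t\<close>, so that \<open>F\<close> becomes the
    polynomial map.\<close>
  define A where "A = a * \<alpha> ^ n"
  define B where "B = b * \<beta> ^ n"
  interpret weighted_power_map q "TYPE('a)" u v \<alpha> \<beta> r n A B
    using assms u v \<alpha> \<beta> by unfold_locales (auto simp: A_def B_def)
  have "poly (f_poly q r (B_poly n u v a b)) c = F c" for c
  proof (cases "c = 0")
    case True
    thus ?thesis
      using F_0 assms(3) by (simp add: f_poly_def poly_monom)
  next
    case False
    define x where "x = c ^ (q - 1)"
    have "c ^ q + w * c = c * (w + x)" for w
      by (simp add: x_def power_q algebra_simps)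
    hence "F c = c ^ r * (a * (u + x) ^ n + b * (v + x) ^ n)"
      using False \<alpha> \<beta> unfolding F_def M_def s_def t_def unfolding A_def B_def
      by (simp add: power_divide power_mult_distrib) (simp add: field_simps)
    thus ?thesis
      by (simp add: f_poly_def B_poly_def poly_monom poly_pcompose x_def)
  qed
  hence "permutation_polynomial (f_poly q r (B_poly n u v a b)) \<longleftrightarrow> inj F"
    using finite_UNIV_inj_surj[OF finite, of F]
    by (auto simp: permutation_polynomial_def bij_def)
  moreover have "A / B \<in> K \<longleftrightarrow> (b / a) ^ (q - 1) = (v / u) ^ n"
  proof -
    \<comment> \<open>The line equations bring \<open>u\<close> and \<open>v\<close> into
      \<open>(A / B) ^ (q - 1)\<close>, which equals 1 exactly when \<open>A / B\<close> lies in
      \<open>K\<close>.\<close>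
    have "\<alpha> ^ (q - 1) = 1 / u" "\<beta> ^ (q - 1) = 1 / v"
      using \<alpha> \<beta> u v by (simp_all add: power_q field_simps)
    hence "(\<alpha> ^ n) ^ (q - 1) = 1 / u ^ n" "(\<beta> ^ n) ^ (q - 1) = 1 / v ^ n"
      by (metis mult.commute power_mult power_one_over)+
    hence "(A / B) ^ (q - 1) = (v / u) ^ n / (b / a) ^ (q - 1)"
      by (simp add: A_def B_def power_divide power_mult_distrib)
    moreover have "A / B \<noteq> 0"
      using A_nz B_nz by simp
    ultimately show ?thesis
      using K_iff[of "A / B"] assms(9,10) by (simp only: divide_eq_1_iff) auto
  qed
  ultimately show ?thesis
    using inj_F_iff unfolding coprime_iff_gcd_eq_1 by metis
qed

end
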